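(* Let $L(y\mid\theta)$ be a family of probability distributions of a random variable $\mathbf y$, parametrized by $\theta$, and let $p(\theta\mid w)$ be a family of prior distributions of $\theta$, parametrized by $w$. Let $$p_{\rm pred}(y\mid w):=\int L(y\mid\theta)\,p(\theta\mid w)\,d\theta$$ be the predictive distribution and, given an observation $\mathbf y=y$, let $$p_{\rm post}(\theta\mid w,y):=\frac{L(y\mid\theta)\,p(\theta\mid w)}{p_{\rm pred}(y\mid w)}$$ be the posterior distribution of $\theta$ determined by the Bayes rule. Let $$K(w,y):=D_{\rm KL}(p_{\rm post}\,\|\,p)=\int p_{\rm post}(\theta\mid w,y)\,\ln\frac{p_{\rm post}(\theta\mid w,y)}{p(\theta\mid w)}\,d\theta$$ be the Kullback--Leibler divergence, and let $\nabla_w K(w,y)$ denote its gradient with respect to $w$ computed with $w$ in the posterior distribution frozen, i.e. not differentiated. Then $$\nabla_w K(w,y)=-\nabla_w\ln p_{\rm pred}(y\mid w).$$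
   Context: The parameter $\theta$ is treated as a random variable with prior distribution $p(\theta\mid w)$. The posterior $p_{\rm post}(\theta\mid w,y)$ need not belong to the same family as the prior $p(\theta\mid w)$. The frozen-posterior convention means that, when the gradient of $K(w,y)$ with respect to $w$ is taken, $p_{\rm post}(\theta\mid w,y)$ is held fixed and only the dependence on $w$ through the prior $p(\theta\mid w)$ is differentiated. *)

theory Defs
  imports "HOL-Probability.Probability"
begin

text \<open>All densities are taken with respect to a fixed reference measure: \<open>M\<close> on the space of
  \<open>\<theta>\<close> (Lebesgue measure \<^term>\<open>lborel\<close> being the case of the integral \<open>d\<theta>\<close>) and \<open>N\<close> on the space
  of observations. Arguments are ordered with the conditioning variable first: \<open>L \<theta> y\<close> is
  \<open>L(y | \<theta>)\<close> and \<open>p w \<theta>\<close> is \<open>p(\<theta> | w)\<close>.\<close>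

definition prob_density :: "'a measure \<Rightarrow> ('a \<Rightarrow> real) \<Rightarrow> bool" where
  "prob_density M f \<longleftrightarrow>
     f \<in> borel_measurable M \<and> (\<forall>x\<in>space M. 0 \<le> f x) \<and> prob_space (density M f)"

definition predictive ::
  "'t measure \<Rightarrow> ('t \<Rightarrow> 'y \<Rightarrow> real) \<Rightarrow> ('w \<Rightarrow> 't \<Rightarrow> real) \<Rightarrow> 'w \<Rightarrow> 'y \<Rightarrow> real" where
  "predictive M L p w y = (\<integral>\<theta>. L \<theta> y * p w \<theta> \<partial>M)"

definition posterior ::
  "'t measure \<Rightarrow> ('t \<Rightarrow> 'y \<Rightarrow> real) \<Rightarrow> ('w \<Rightarrow> 't \<Rightarrow> real) \<Rightarrow> 'w \<Rightarrow> 'y \<Rightarrow> 't \<Rightarrow> real" where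
  "posterior M L p w y \<theta> = L \<theta> y * p w \<theta> / predictive M L p w y"

text \<open>Kullback--Leibler divergence \<open>D\<^sub>K\<^sub>L(q || p)\<close> of densities, with the natural logarithm.
  In \<^const>\<open>KL_divergence\<close> the reference distribution \<open>p\<close> comes first.\<close>

definition KL :: "'t measure \<Rightarrow> ('t \<Rightarrow> real) \<Rightarrow> ('t \<Rightarrow> real) \<Rightarrow> real" where
  "KL M q p = KL_divergence (exp 1) (density M p) (density M q)"

text \<open>\<^const>\<open>KL_divergence\<close> is real-valued and carries no information when the divergence is
  infinite. The negative part of the integrand is always integrable, so the following says exactly
  that the divergence is finite.\<close>

definition KL_finite :: "'t measure \<Rightarrow> ('t \<Rightarrow> real) \<Rightarrow> ('t \<Rightarrow> real) \<Rightarrow> bool" where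
  "KL_finite M q p \<longleftrightarrow>
     (AE \<theta> in M. p \<theta> = 0 \<longrightarrow> q \<theta> = 0) \<and> integrable M (\<lambda>\<theta>. q \<theta> * ln (q \<theta> / p \<theta>))"

lemma KL_eq_integral:
  assumes "sigma_finite_measure M" "prob_density M p" "prob_density M q" "KL_finite M q p"
  shows "KL M q p = (\<integral>\<theta>. q \<theta> * ln (q \<theta> / p \<theta>) \<partial>M)"
proof -
  interpret sigma_finite_measure M by fact
  have "1 < (exp 1 :: real)" by simp
  moreover have "log (exp 1) x = ln x" for x :: real by (simp add: log_def)
  ultimately show ?thesis
    using assms KL_density_density[of "exp 1" p q]
    unfolding KL_def KL_finite_def prob_density_def by (simp add: AE_I2)
qed

text \<open>\<open>K_frozen M L p v w y\<close> is \<open>D\<^sub>K\<^sub>L(p\<^sub>p\<^sub>o\<^sub>s\<^sub>t(\<cdot> | v, y) || p(\<cdot> | w))\<close>, so that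
  \<open>K(w, y) = K_frozen M L p w w y\<close>, and the gradient of \<open>K\<close> at \<open>w\<close> with frozen posterior is the
  gradient at \<open>w\<close> of \<open>K_frozen M L p w u y\<close> as a function of \<open>u\<close>.\<close>

definition K_frozen ::
  "'t measure \<Rightarrow> ('t \<Rightarrow> 'y \<Rightarrow> real) \<Rightarrow> ('w \<Rightarrow> 't \<Rightarrow> real) \<Rightarrow> 'w \<Rightarrow> 'w \<Rightarrow> 'y \<Rightarrow> real" where
  "K_frozen M L p v w y = KL M (posterior M L p v y) (p w)"

end

theory Submission
  imports Defs
begin

text \<open>
  The two gradients are compared through a minimum, rather than by moving them inside the
  integrals. With \<open>q\<close> the posterior at the fixed parameter \<open>w\<close>, consider the function of \<open>u\<close>

  \<open>F u = D\<^sub>K\<^sub>L(q || p(\<cdot> | u)) + ln p\<^sub>p\<^sub>r\<^sub>e\<^sub>d(y | u)\<close>.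

  Since \<open>p(\<cdot> | u) = p\<^sub>p\<^sub>o\<^sub>s\<^sub>t(\<cdot> | u, y) p\<^sub>p\<^sub>r\<^sub>e\<^sub>d(y | u) / L(y | \<cdot>)\<close>, formally
  \<open>F u = D\<^sub>K\<^sub>L(q || p\<^sub>p\<^sub>o\<^sub>s\<^sub>t(\<cdot> | u, y)) + \<integral> q ln L\<close>, where only the first term depends on \<open>u\<close>; it is
  nonnegative and vanishes at \<open>u = w\<close>. So \<open>F\<close> has a minimum at \<open>w\<close>
  (\<open>KL_posterior_add_ln_predictive_minimal\<close>), and its gradient there, the sum of the two gradients
  in the theorem, is zero (\<open>GDERIV_local_min_zero\<close>).
\<close>

lemma GDERIV_local_min_zero:
  fixes f :: "'a::real_inner \<Rightarrow> real"
  assumes "GDERIV f x :> D" and "\<forall>\<^sub>F u in nhds x. f x \<le> f u"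
  shows "D = 0"
proof -
  obtain S where S: "open S" "x \<in> S" "\<And>u. u \<in> S \<Longrightarrow> f x \<le> f u"
    using assms(2) by (auto simp: eventually_nhds)
  have "(f has_derivative (\<lambda>h. inner h D)) (at x)"
    using assms(1) by (simp add: gderiv_def)
  then have "(\<lambda>h. inner h D) = (\<lambda>h. 0)"
    using S by (intro differential_zero_maxmin[of x S f]) auto
  then have "inner D D = 0" by (rule fun_cong)
  then show ?thesis by simp
qed

lemma integral_posterior:
  assumes "predictive M L p u y > 0"
  shows "(\<integral>\<theta>. posterior M L p u y \<theta> \<partial>M) = 1"
proof -
  have "(\<integral>\<theta>. posterior M L p u y \<theta> \<partial>M) = predictive M L p u y / predictive M L p u y"
    unfolding posterior_def by (simp add: predictive_def)
  with assms show ?thesis by simp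
qed

lemma prob_density_posterior:
  assumes "\<And>\<theta>. \<theta> \<in> space M \<Longrightarrow> 0 \<le> L \<theta> y" and "prob_density M (p u)"
    and "integrable M (\<lambda>\<theta>. L \<theta> y * p u \<theta>)" and "predictive M L p u y > 0"
  shows "prob_density M (posterior M L p u y)"
proof -
  let ?q = "posterior M L p u y"
  have int: "integrable M ?q"
    using assms(3) unfolding posterior_def by simp
  have nn: "0 \<le> ?q \<theta>" if "\<theta> \<in> space M" for \<theta>
    using assms that by (simp add: posterior_def prob_density_def)
  have "(\<integral>\<^sup>+\<theta>. ennreal (?q \<theta>) \<partial>M) = 1"
    using int nn integral_posterior[OF assms(4)]
    by (subst nn_integral_eq_integral) auto
  then have "prob_space (density M ?q)"
    using int by (intro prob_spaceI)
      (auto simp: emeasure_density cong: nn_integral_cong)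
  then show ?thesis
    using int nn by (simp add: prob_density_def)
qed

text \<open>Gibbs' inequality between the posteriors at \<open>w\<close> and at \<open>u\<close>, written through the priors:
  integrate \<open>q ln t \<le> q (t - 1)\<close> with \<open>t\<close> the ratio of the posterior at \<open>u\<close> to \<open>q\<close>. In \<open>t\<close> the
  likelihood cancels, so \<open>q ln t\<close> is the difference of the two Kullback--Leibler integrands plus a
  constant multiple of \<open>q\<close>; and \<open>q (t - 1)\<close> is at most the difference of two probability
  densities, which integrates to zero.\<close>

lemma KL_posterior_add_ln_predictive_minimal:
  assumes "sigma_finite_measure M"
    and L: "\<And>\<theta>. \<theta> \<in> space M \<Longrightarrow> 0 \<le> L \<theta> y"
    and pw: "prob_density M (p w)" and pu: "prob_density M (p u)"
    and iw: "integrable M (\<lambda>\<theta>. L \<theta> y * p w \<theta>)" and iu: "integrable M (\<lambda>\<theta>. L \<theta> y * p u \<theta>)"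
    and Zw: "predictive M L p w y > 0" and Zu: "predictive M L p u y > 0"
    and fw: "KL_finite M (posterior M L p w y) (p w)"
    and fu: "KL_finite M (posterior M L p w y) (p u)"
  shows "K_frozen M L p w w y + ln (predictive M L p w y)
    \<le> K_frozen M L p w u y + ln (predictive M L p u y)"
proof -
  let ?q = "posterior M L p w y" and ?r = "posterior M L p u y"
  let ?c = "ln (predictive M L p w y) - ln (predictive M L p u y)"
  let ?f = "\<lambda>v \<theta>. ?q \<theta> * ln (?q \<theta> / p v \<theta>)"
  have q: "prob_density M ?q"
    by (rule prob_density_posterior[OF L pw iw Zw])
  have K: "K_frozen M L p w w y = (\<integral>\<theta>. ?f w \<theta> \<partial>M)" "K_frozen M L p w u y = (\<integral>\<theta>. ?f u \<theta> \<partial>M)"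
    unfolding K_frozen_def
    by (rule KL_eq_integral[OF assms(1) pw q fw], rule KL_eq_integral[OF assms(1) pu q fu])
  have int: "integrable M (?f w)" "integrable M (?f u)" "integrable M ?q" "integrable M ?r"
    using fw fu iw iu unfolding KL_finite_def posterior_def by auto
  have ac: "AE \<theta> in M. p u \<theta> = 0 \<longrightarrow> ?q \<theta> = 0"
    using fu by (simp add: KL_finite_def)
  \<comment> \<open>Where \<open>q\<close> vanishes the posterior at \<open>u\<close> may still be positive, hence only an inequality there.\<close>
  have "AE \<theta> in M. ?f w \<theta> - ?f u \<theta> + ?q \<theta> * ?c \<le> ?r \<theta> - ?q \<theta>"
    using ac AE_space
  proof eventually_elim
    case (elim \<theta>)
    have nn: "0 \<le> p w \<theta>" "0 \<le> p u \<theta>" "0 \<le> L \<theta> y"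
      using elim(2) pw pu L by (auto simp: prob_density_def)
    show ?case
    proof (cases "?q \<theta> = 0")
      case True
      moreover have "0 \<le> ?r \<theta>" using nn Zu by (simp add: posterior_def)
      ultimately show ?thesis by simp
    next
      case False
      then have pos: "0 < p w \<theta>" "0 < L \<theta> y" "0 < p u \<theta>"
        using nn elim(1) by (auto simp: posterior_def less_le)
      then have q0: "0 < ?q \<theta>" using Zw by (simp add: posterior_def)
      define t where
        "t = p u \<theta> / p w \<theta> * (predictive M L p w y / predictive M L p u y)"
      have "0 < t" using pos Zw Zu by (simp add: t_def)
      have "ln (?q \<theta> / p w \<theta>) - ln (?q \<theta> / p u \<theta>) + ?c = ln t"
        using pos q0 Zw Zu by (simp add: t_def ln_div ln_mult)
      also have "\<dots> \<le> t - 1" using \<open>0 < t\<close> by (rule ln_le_minus_one)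
      finally have "?q \<theta> * (ln (?q \<theta> / p w \<theta>) - ln (?q \<theta> / p u \<theta>) + ?c) \<le> ?q \<theta> * (t - 1)"
        using q0 by (intro mult_left_mono) auto
      moreover have "?q \<theta> * t = ?r \<theta>"
        using pos Zw Zu by (simp add: t_def posterior_def)
      ultimately show ?thesis by (simp add: algebra_simps)
    qed
  qed
  then have "(\<integral>\<theta>. ?f w \<theta> - ?f u \<theta> + ?q \<theta> * ?c \<partial>M) \<le> (\<integral>\<theta>. ?r \<theta> - ?q \<theta> \<partial>M)"
    using int by (intro integral_mono_AE) auto
  then have "(\<integral>\<theta>. ?f w \<theta> \<partial>M) - (\<integral>\<theta>. ?f u \<theta> \<partial>M) + ?c \<le> 0"
    using int integral_posterior[OF Zw] integral_posterior[OF Zu] by simp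
  then show ?thesis using K by simp
qed

theorem lemma2p1:
  fixes M :: "'t measure" and N :: "'y measure"
    and L :: "'t \<Rightarrow> 'y \<Rightarrow> real"
    and p :: "'w::euclidean_space \<Rightarrow> 't \<Rightarrow> real"
    and W :: "'w set" and w gK gpred :: 'w and y :: 'y
  assumes "sigma_finite_measure M"
    and "\<And>\<theta>. \<theta> \<in> space M \<Longrightarrow> prob_density N (L \<theta>)"
    and "open W" and "w \<in> W"
    and "\<And>u. u \<in> W \<Longrightarrow> prob_density M (p u)"
    and "y \<in> space N"
    and "\<And>u. u \<in> W \<Longrightarrow> integrable M (\<lambda>\<theta>. L \<theta> y * p u \<theta>)"
    and "\<And>u. u \<in> W \<Longrightarrow> predictive M L p u y > 0"
    and "\<forall>\<^sub>F u in nhds w. KL_finite M (posterior M L p w y) (p u)"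
    and "GDERIV (\<lambda>u. K_frozen M L p w u y) w :> gK"
    and "GDERIV (\<lambda>u. ln (predictive M L p u y)) w :> gpred"
  shows "gK = - gpred"
proof -
  have L: "0 \<le> L \<theta> y" if "\<theta> \<in> space M" for \<theta>
    using assms(2)[OF that] assms(6) by (simp add: prob_density_def)
  have fw: "KL_finite M (posterior M L p w y) (p w)"
    using assms(9) by (rule eventually_nhds_x_imp_x)
  have "\<forall>\<^sub>F u in nhds w. u \<in> W"
    using assms(3,4) by (rule eventually_nhds_in_open)
  with assms(9) have "\<forall>\<^sub>F u in nhds w. K_frozen M L p w w y + ln (predictive M L p w y)
      \<le> K_frozen M L p w u y + ln (predictive M L p u y)"
  proof eventually_elim
    case (elim u)
    show ?case
      using assms(1) L assms(5)[OF assms(4)] assms(5)[OF elim(2)] assms(7)[OF assms(4)]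
        assms(7)[OF elim(2)] assms(8)[OF assms(4)] assms(8)[OF elim(2)] fw elim(1)
      by (rule KL_posterior_add_ln_predictive_minimal)
  qed
  with GDERIV_add[OF assms(10,11)] have "gK + gpred = 0"
    by (rule GDERIV_local_min_zero)
  then show ?thesis by (simp add: eq_neg_iff_add_eq_0)
qed

end
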